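(* A topological group is $\mathbb R^{\omega_1}$-factorizable if and only if it is $\omega$-narrow and $\omega_1$-fine.
   Context: All topological spaces (including those underlying topological groups) are assumed to be Tychonoff. A space $X$ is $\mathbb R^{\omega_1}$-factorizable if for every continuous function $f\colon X\to\mathbb R^{\omega_1}$ there exist a second-countable space $Y$ and continuous functions $h\colon X\to Y$ and $g\colon Y\to\mathbb R^{\omega_1}$ such that $f=g\circ h$. A topological group is called $\mathbb R^{\omega_1}$-factorizable if its underlying topological space is. A topological group $G$ is $\omega$-narrow if, given any neighborhood $U$ of the identity element of $G$, there exists a countable set $A\subset G$ for which $U\cdot A=G$. A filter $\mathscr F$ on a set is an $A$-filter if, given any $F_\alpha\in\mathscr F$, $\alpha<\omega_1$, there exist $G_n\in\mathscr F$, $n<\omega$, such that each $F_\alpha$ contains $G_{n_\alpha}$ for some $n_\alpha<\omega$. A topological group is $\omega_1$-fine if the filter of neighborhoods of its identity element is an $A$-filter. *)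

theory Defs
  imports "HOL-Analysis.Analysis" "HOL-Algebra.Coset"
begin

definition Tychonoff_space :: "'a topology \<Rightarrow> bool"
  where "Tychonoff_space X \<longleftrightarrow> completely_regular_space X \<and> Hausdorff_space X"

text \<open>The cardinal \<open>\<omega>\<^sub>1\<close>: the underlying set of the successor cardinal of \<open>\<aleph>\<^sub>0\<close>.\<close>

definition omega1 :: "nat set set"
  where "omega1 = Field (cardSuc natLeq)"

lemma card_omega1: "(card_of omega1, cardSuc natLeq) \<in> ordIso"
  unfolding omega1_def
  by (intro card_of_Field_ordIso cardSuc_Card_order natLeq_Card_order)

abbreviation R_omega1 :: "(nat set \<Rightarrow> real) topology"
  where "R_omega1 \<equiv> powertop_real omega1"

text \<open>The intermediate space \<open>Y\<close> ranges over topologies on subsets of the type \<^typ>\<open>nat set\<close>.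
  This is no restriction: every second-countable Hausdorff space of any type is homeomorphic to
  one of these, and the lemma \<open>R_omega1_factorizableI\<close> below allows \<open>Y\<close> of arbitrary type.\<close>

definition R_omega1_factorizable :: "'a topology \<Rightarrow> bool"
  where "R_omega1_factorizable X \<longleftrightarrow>
    (\<forall>f. continuous_map X R_omega1 f \<longrightarrow>
      (\<exists>(Y :: nat set topology) h g.
         Tychonoff_space Y \<and> second_countable Y \<and>
         continuous_map X Y h \<and> continuous_map Y R_omega1 g \<and>
         (\<forall>x\<in>topspace X. f x = g (h x))))"

lemma second_countable_homeomorphic_nat_set_topology:
  assumes "second_countable Y" "Hausdorff_space Y"
  shows "\<exists>Z :: nat set topology. Y homeomorphic_space Z"
proof -
  obtain \<B> where \<B>: "countable \<B>" "\<And>V. V \<in> \<B> \<Longrightarrow> openin Y V"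
    "\<And>U x. openin Y U \<Longrightarrow> x \<in> U \<Longrightarrow> \<exists>V\<in>\<B>. x \<in> V \<and> V \<subseteq> U"
    using assms(1) unfolding second_countable_def by metis
  define e where "e x = to_nat_on \<B> ` {V \<in> \<B>. x \<in> V}" for x
  have inj: "inj_on e (topspace Y)"
  proof (rule inj_onI, rule ccontr)
    fix x y assume xy: "x \<in> topspace Y" "y \<in> topspace Y" "e x = e y" "x \<noteq> y"
    then obtain U where U: "openin Y U" "x \<in> U" "y \<notin> U"
      using assms(2) unfolding Hausdorff_space_def disjnt_iff by metis
    then obtain V where V: "V \<in> \<B>" "x \<in> V" "y \<notin> V"
      using \<B>(3) by blast
    then have "to_nat_on \<B> V \<in> e y"
      using xy(3) unfolding e_def by blast
    then obtain W where "W \<in> \<B>" "y \<in> W" "to_nat_on \<B> V = to_nat_on \<B> W"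
      unfolding e_def by blast
    then show False
      using V inj_on_to_nat_on[OF \<B>(1)] by (metis inj_onD)
  qed
  define d where "d = inv_into (topspace Y) e"
  define Z where "Z = pullback_topology (e ` topspace Y) d Y"
  have de: "d (e x) = x" if "x \<in> topspace Y" for x
    using inj that by (simp add: d_def)
  have top: "topspace Z = e ` topspace Y"
    unfolding Z_def topspace_pullback_topology using de by auto
  have "continuous_map Y Z e"
    unfolding Z_def
  proof (rule continuous_map_pullback')
    show "continuous_map Y Y (d \<circ> e)"
      by (rule continuous_map_eq[OF continuous_map_id]) (simp add: de)
    show "topspace Y \<subseteq> e -` e ` topspace Y"
      by blast
  qed
  moreover have "continuous_map Z Y d"
    using continuous_map_pullback[OF continuous_map_id, of "e ` topspace Y" d Y] 
    by (simp add: Z_def)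
  ultimately have "homeomorphic_maps Y Z e d"
    unfolding homeomorphic_maps_def using de by (auto simp: top)
  then show ?thesis
    unfolding homeomorphic_space_def by blast
qed

lemma R_omega1_factorizableI:
  assumes "\<And>f. continuous_map X R_omega1 f \<Longrightarrow>
    \<exists>(Y :: 'b topology) h g.
         Tychonoff_space Y \<and> second_countable Y \<and>
         continuous_map X Y h \<and> continuous_map Y R_omega1 g \<and>
         (\<forall>x\<in>topspace X. f x = g (h x))"
  shows "R_omega1_factorizable X"
  unfolding R_omega1_factorizable_def
proof (intro allI impI)
  fix f assume "continuous_map X R_omega1 f"
  then obtain Y :: "'b topology" and h g where Y: "Tychonoff_space Y" "second_countable Y"
    and hg: "continuous_map X Y h" "continuous_map Y R_omega1 g" "\<forall>x\<in>topspace X. f x = g (h x)"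
    using assms by blast
  obtain Z :: "nat set topology" where YZ: "Y homeomorphic_space Z"
    using second_countable_homeomorphic_nat_set_topology Y unfolding Tychonoff_space_def by blast
  then obtain e d where ed: "homeomorphic_maps Y Z e d"
    unfolding homeomorphic_space_def by blast
  have "Tychonoff_space Z" "second_countable Z"
    using Y YZ homeomorphic_completely_regular_space homeomorphic_Hausdorff_space
      homeomorphic_space_second_countability unfolding Tychonoff_space_def by blast+
  moreover have "continuous_map X Z (e \<circ> h)" "continuous_map Z R_omega1 (g \<circ> d)"
    using ed hg unfolding homeomorphic_maps_def by (auto intro: continuous_map_compose)
  moreover have "\<forall>x\<in>topspace X. f x = (g \<circ> d) ((e \<circ> h) x)"
    using ed hg unfolding homeomorphic_maps_def continuous_map_def by (auto simp: Pi_iff)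
  ultimately show "\<exists>(Z :: nat set topology) h g.
         Tychonoff_space Z \<and> second_countable Z \<and>
         continuous_map X Z h \<and> continuous_map Z R_omega1 g \<and>
         (\<forall>x\<in>topspace X. f x = g (h x))"
    by blast
qed

locale topological_group = group G for G (structure) +
  fixes T :: "'a topology"
  assumes topspace_eq: "topspace T = carrier G"
    and continuous_mult: "continuous_map (prod_topology T T) T (\<lambda>(x, y). x \<otimes> y)"
    and continuous_inv: "continuous_map T T (\<lambda>x. inv x)"
    and Tychonoff: "Tychonoff_space T"

definition omega_narrow :: "('a, 'b) monoid_scheme \<Rightarrow> 'a topology \<Rightarrow> bool"
  where "omega_narrow G T \<longleftrightarrow>
    (\<forall>U. U \<subseteq> carrier G \<and> eventually (\<lambda>x. x \<in> U) (nhdsin T \<one>\<^bsub>G\<^esub>) \<longrightarrow>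
      (\<exists>A. countable A \<and> A \<subseteq> carrier G \<and> U <#>\<^bsub>G\<^esub> A = carrier G))"

text \<open>A set \<open>S\<close> belongs to a filter \<open>F\<close> of type \<^typ>\<open>'a filter\<close> iff
  \<open>eventually (\<lambda>x. x \<in> S) F\<close>.\<close>

definition A_filter :: "'a filter \<Rightarrow> bool"
  where "A_filter F \<longleftrightarrow>
    (\<forall>S :: nat set \<Rightarrow> 'a set.
      (\<forall>\<alpha>\<in>omega1. eventually (\<lambda>x. x \<in> S \<alpha>) F) \<longrightarrow>
      (\<exists>H :: nat \<Rightarrow> 'a set. (\<forall>n. eventually (\<lambda>x. x \<in> H n) F) \<and>
         (\<forall>\<alpha>\<in>omega1. \<exists>n. H n \<subseteq> S \<alpha>)))"

text \<open>The filter \<^term>\<open>nhdsin T x\<close> lives on the whole type and contains \<^term>\<open>topspace T\<close>.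
  Its trace on \<^term>\<open>topspace T\<close> is the neighbourhood filter of \<open>x\<close>; being an A-filter does not
  depend on which of the two is used.\<close>

definition omega1_fine :: "('a, 'b) monoid_scheme \<Rightarrow> 'a topology \<Rightarrow> bool"
  where "omega1_fine G T \<longleftrightarrow> A_filter (nhdsin T \<one>\<^bsub>G\<^esub>)"

end

theory Submission
  imports Defs "HOL-Library.Countable_Set_Type"
begin

text \<open>
  A map into \<open>\<real>\<close> to the power \<open>\<omega>\<^sub>1\<close> is nothing but a family of \<open>\<omega>\<^sub>1\<close> continuous real
  functions, so factorizability says that any \<open>\<omega>\<^sub>1\<close> such functions are simultaneously continuous
  with respect to one coarser second-countable topology.

  For the forward direction this is applied to bump functions. Bumps at the identity, one supported
  in each of \<open>\<omega>\<^sub>1\<close> given neighbourhoods, factor through some \<open>h : G \<rightarrow> Y\<close>, and the preimages of a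
  countable base at \<open>h \<one>\<close> are the countably many neighbourhoods demanded of an A-filter
  (\<open>factorizable_imp_omega1_fine\<close>). If \<open>G\<close> is not narrow, some neighbourhood \<open>V\<close> of the identity admits
  points \<open>x\<^sub>\<alpha>\<close>, \<open>\<alpha> < \<omega>\<^sub>1\<close>, no one of which lies in the translate \<open>x\<^sub>\<beta> V\<close> of another; bumps on
  these translates then make the points \<open>h x\<^sub>\<alpha>\<close> an uncountable discrete subspace of \<open>Y\<close>, which is
  impossible (\<open>factorizable_imp_omega_narrow\<close>).

  The heart of the converse is a covering property of Lindelof type
  (\<open>nbhd_assignment_countable_cover\<close>): if \<open>G\<close> is narrow and fine, then for every choice of
  neighbourhoods \<open>V x\<close> of the identity countably many translates \<open>d (V d)\<close> cover \<open>G\<close>. A maximal set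
  of points that are far apart in the sense of the \<open>V x\<close> yields such a cover, and it is countable: were
  it not, the A-filter property would provide one neighbourhood contained in uncountably many of the
  \<open>V x\<close>, and narrowness would place two of the corresponding points too close together.

  It follows that the continuity of a real function on \<open>G\<close> is governed, at all points at once, by
  countably many neighbourhoods of the identity (\<open>omega_uniformly_continuous\<close>), and the A-filter
  property makes one countable family serve \<open>\<omega>\<^sub>1\<close> functions (\<open>nbhd_sequence_for_family\<close>). By narrowness,
  countably many translates of a single bump function recognize whether two points are close with
  respect to a given neighbourhood (\<open>translates_detect_nbhd\<close>). All these translates together map
  \<open>G\<close> into \<open>\<real>\<^bsup>\<omega>\<^esup>\<close>, and the image is the required second-countable space.
\<close>

section \<open>Uncountable sets\<close>

lemma uncountable_omega1: "uncountable omega1"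
proof
  assume "countable omega1"
  then have "(card_of omega1, natLeq) \<in> ordLeq"
    by (simp add: countable_card_le_natLeq)
  moreover have "(natLeq, card_of omega1) \<in> ordLess"
    using cardSuc_greater[OF natLeq_Card_order] card_omega1 ordIso_symmetric ordLess_ordIso_trans
    by blast
  ultimately show False
    using not_ordLess_ordLeq by blast
qed

text \<open>The least uncountable cardinal embeds in every uncountable set; this turns uncountable sets
  into families indexed by \<open>\<omega>\<^sub>1\<close>, as the definitions of factorizability and of A-filters require.\<close>

lemma uncountable_inj_omega1:
  assumes "uncountable A"
  obtains e where "inj_on e omega1" "e ` omega1 \<subseteq> A"
proof -
  have "(natLeq, card_of A) \<in> ordLess"
    using assms natLeq_Card_order card_of_Well_order natLeq_Well_order not_ordLeq_iff_ordLess
    unfolding countable_card_le_natLeq by blast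
  then have "(cardSuc natLeq, card_of A) \<in> ordLeq"
    by (rule cardSuc_least[OF natLeq_Card_order card_of_Card_order])
  then have "(card_of omega1, card_of A) \<in> ordLeq"
    using card_omega1 ordIso_ordLeq_trans by blast
  then show ?thesis
    using that card_of_ordLeq by metis
qed

text \<open>Zorn's lemma in the form used for points that are far apart: with \<open>R\<close> read as closeness, a maximal
  set of pairwise far points is close to every point outside it.\<close>

lemma maximal_unrelated_subset:
  assumes sym: "\<And>x y. R x y \<Longrightarrow> R y x"
  obtains D where "D \<subseteq> S" "\<And>x y. x \<in> D \<Longrightarrow> y \<in> D \<Longrightarrow> x \<noteq> y \<Longrightarrow> \<not> R x y"
    "\<And>x. x \<in> S - D \<Longrightarrow> \<exists>d\<in>D. R d x"
proof -
  define \<P> where "\<P> = {D. D \<subseteq> S \<and> pairwise (\<lambda>x y. \<not> R x y) D}"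
  have "\<exists>M\<in>\<P>. \<forall>X\<in>\<P>. M \<subseteq> X \<longrightarrow> X = M"
  proof (rule subset_Zorn')
    fix C assume "subset.chain \<P> C"
    then have C: "\<And>A. A \<in> C \<Longrightarrow> A \<subseteq> S" "\<And>A. A \<in> C \<Longrightarrow> pairwise (\<lambda>x y. \<not> R x y) A"
      "chain\<^sub>\<subseteq> C"
      unfolding subset_chain_def \<P>_def chain_subset_def by auto
    have "pairwise (\<lambda>x y. \<not> R x y) (\<Union>C)"
      using C(2,3) by (rule pairwise_chain_Union)
    then show "\<Union>C \<in> \<P>"
      using C(1) by (simp add: \<P>_def Sup_le_iff)
  qed
  then obtain D where D: "D \<in> \<P>" "\<And>X. X \<in> \<P> \<Longrightarrow> D \<subseteq> X \<Longrightarrow> X = D"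
    by blast
  have "\<exists>d\<in>D. R d x" if x: "x \<in> S - D" for x
  proof (rule ccontr)
    assume "\<not> (\<exists>d\<in>D. R d x)"
    then have "insert x D \<in> \<P>"
      using D(1) x sym unfolding \<P>_def pairwise_def by auto
    then show False
      using D(2)[of "insert x D"] x by blast
  qed
  then show ?thesis
    using D(1) that[of D] by (simp add: \<P>_def pairwise_def)
qed

text \<open>Basic open sets chosen around the points inside their separating sets must be distinct, so the
  family is no larger than a base. Hence a discrete subspace of a second-countable space is countable.\<close>

lemma second_countable_imp_countable_separated_family:
  assumes "second_countable Y" 
    and "\<And>i. i \<in> I \<Longrightarrow> openin Y (V i)" "\<And>i. i \<in> I \<Longrightarrow> y i \<in> V i"
    and "\<And>i j. i \<in> I \<Longrightarrow> j \<in> I \<Longrightarrow> y j \<in> V i \<Longrightarrow> i = j"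
  shows "countable I"
proof -
  obtain \<B> where \<B>: "countable \<B>" 
    "\<And>U x. openin Y U \<Longrightarrow> x \<in> U \<Longrightarrow> \<exists>B\<in>\<B>. x \<in> B \<and> B \<subseteq> U"
    using assms(1) unfolding second_countable_def by metis
  have "\<forall>i\<in>I. \<exists>B. B \<in> \<B> \<and> y i \<in> B \<and> B \<subseteq> V i"
    using \<B>(2)[OF assms(2,3)] by blast
  then obtain B where B: "\<And>i. i \<in> I \<Longrightarrow> B i \<in> \<B> \<and> y i \<in> B i \<and> B i \<subseteq> V i"
    by metis
  have "inj_on B I"
  proof (rule inj_onI)
    fix i j assume ij: "i \<in> I" "j \<in> I" "B i = B j"
    then have "y j \<in> V i"
      using B[of i] B[of j] by auto
    then show "i = j"
      using assms(4) ij by blast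
  qed
  moreover have "B ` I \<subseteq> \<B>"
    using B by blast
  ultimately show ?thesis
    using \<B>(1) countable_subset countable_image_inj_on by metis
qed

section \<open>Factorization of real functions\<close>

text \<open>The form in which factorizability is used: continuity into the power is coordinatewise,
  so the coordinates may be handled as separate real functions.\<close>

lemma R_omega1_factorizable_imp_family_factors:
  assumes "R_omega1_factorizable X"
    and "\<And>\<alpha>. \<alpha> \<in> omega1 \<Longrightarrow> continuous_map X euclideanreal (\<phi> \<alpha>)"
  obtains Y :: "nat set topology" and h g where "second_countable Y" "continuous_map X Y h"
    "\<And>\<alpha>. \<alpha> \<in> omega1 \<Longrightarrow> continuous_map Y euclideanreal (g \<alpha>)"
    "\<And>\<alpha> x. \<alpha> \<in> omega1 \<Longrightarrow> x \<in> topspace X \<Longrightarrow> g \<alpha> (h x) = \<phi> \<alpha> x"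
proof -
  have "continuous_map X R_omega1 (\<lambda>x. \<lambda>\<alpha>\<in>omega1. \<phi> \<alpha> x)"
    unfolding continuous_map_componentwise using assms(2) by auto
  with assms(1) have "\<exists>(Y :: nat set topology) h g. Tychonoff_space Y \<and> second_countable Y \<and>
      continuous_map X Y h \<and> continuous_map Y R_omega1 g \<and>
      (\<forall>x\<in>topspace X. (\<lambda>\<alpha>\<in>omega1. \<phi> \<alpha> x) = g (h x))"
    unfolding R_omega1_factorizable_def by (elim allE impE)
  then obtain Y :: "nat set topology" and h g where Y: "second_countable Y"
    and h: "continuous_map X Y h" and g: "continuous_map Y R_omega1 g"
    and gh: "\<And>x. x \<in> topspace X \<Longrightarrow> (\<lambda>\<alpha>\<in>omega1. \<phi> \<alpha> x) = g (h x)"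
    by (elim exE conjE) blast
  show ?thesis
  proof (rule that[of Y h "\<lambda>\<alpha> y. g y \<alpha>", OF Y h])
    show "continuous_map Y euclideanreal (\<lambda>y. g y \<alpha>)" if "\<alpha> \<in> omega1" for \<alpha>
      using g that by (simp add: continuous_map_componentwise)
    show "g (h x) \<alpha> = \<phi> \<alpha> x" if "\<alpha> \<in> omega1" "x \<in> topspace X" for \<alpha> x
      using gh[OF that(2)] that(1) by (metis restrict_apply')
  qed
qed

text \<open>A way to prove factorizability: the assumption on \<open>f\<close> and \<open>h\<close> says that every coordinate of \<open>f\<close>
  is continuous for the topology induced by \<open>h\<close>. Hence \<open>f\<close> is constant on the fibres of \<open>h\<close> and
  descends to a continuous map on the image of \<open>h\<close>, a metrizable subspace of \<open>\<real>\<^bsup>\<omega>\<^esup>\<close>.\<close>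

lemma factorization_through_real_sequence:
  fixes h :: "'a \<Rightarrow> nat \<Rightarrow> real"
  assumes f: "continuous_map X R_omega1 f"
    and h: "\<And>n. continuous_map X euclideanreal (\<lambda>x. h x n)"
    and fh: "\<And>\<alpha> x \<epsilon>. \<alpha> \<in> omega1 \<Longrightarrow> x \<in> topspace X \<Longrightarrow> \<epsilon> > 0 \<Longrightarrow>
      \<exists>n. \<exists>\<delta>>0. \<forall>y\<in>topspace X. \<bar>h y n - h x n\<bar> < \<delta> \<longrightarrow> \<bar>f y \<alpha> - f x \<alpha>\<bar> < \<epsilon>"
  shows "\<exists>(Y :: (nat \<Rightarrow> real) topology) h g.
           Tychonoff_space Y \<and> second_countable Y \<and>
           continuous_map X Y h \<and> continuous_map Y R_omega1 g \<and> (\<forall>x\<in>topspace X. f x = g (h x))"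
proof -
  define Y where "Y = top_of_set (h ` topspace X)"
  \<comment> \<open>The descended map is \<open>f \<circ> s\<close> for a section \<open>s\<close> of \<open>h\<close>, which may well be discontinuous.\<close>
  define s where "s = inv_into (topspace X) h"
  have s: "s v \<in> topspace X" "h (s v) = v" if "v \<in> h ` topspace X" for v
    using that unfolding s_def by (auto simp: inv_into_into f_inv_into_f)
  have fext: "f x \<in> extensional omega1" if "x \<in> topspace X" for x
    using f that unfolding continuous_map_componentwise by blast
  have factor: "f x = f (s (h x))" if x: "x \<in> topspace X" for x
  proof (rule extensionalityI[OF fext fext])
    show "s (h x) \<in> topspace X"
      using s x by blast
    fix \<alpha> assume \<alpha>: "\<alpha> \<in> omega1"
    have "\<bar>f (s (h x)) \<alpha> - f x \<alpha>\<bar> < \<epsilon>" if \<epsilon>: "\<epsilon> > 0" for \<epsilon>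
    proof -
      obtain n \<delta> where "\<delta> > 0"
        "\<forall>y\<in>topspace X. \<bar>h y n - h x n\<bar> < \<delta> \<longrightarrow> \<bar>f y \<alpha> - f x \<alpha>\<bar> < \<epsilon>"
        using fh[OF \<alpha> x \<epsilon>] by blast
      moreover have "h (s (h x)) = h x" "s (h x) \<in> topspace X"
        using s x by blast+
      ultimately show ?thesis
        by auto
    qed
    from this[of "\<bar>f (s (h x)) \<alpha> - f x \<alpha>\<bar>"] show "f x \<alpha> = f (s (h x)) \<alpha>"
      by fastforce
  qed (use x in simp)
  have "Tychonoff_space Y"
    unfolding Y_def Tychonoff_space_def
    by (simp add: metrizable_imp_completely_regular_space metrizable_space_subtopology
        metrizable_space_euclidean Hausdorff_space_subtopology)
  moreover have "second_countable Y"
    unfolding Y_def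
  proof (rule second_countable_subtopology)
    obtain \<B> :: "(nat \<Rightarrow> real) set set" where "countable \<B>" "topological_basis \<B>"
      using ex_countable_basis by blast
    then show "second_countable (euclidean :: (nat \<Rightarrow> real) topology)"
      unfolding second_countable_def
    proof (intro exI[of _ \<B>] conjI ballI allI impI)
      show "openin euclidean V" if "V \<in> \<B>" for V
        using topological_basis_open[OF \<open>topological_basis \<B>\<close> that] by simp
      fix U and x :: "nat \<Rightarrow> real" assume "openin euclidean U \<and> x \<in> U"
      then have "open U" "x \<in> U"
        by simp_all
      from topological_basisE[OF \<open>topological_basis \<B>\<close> this]
      show "\<exists>V\<in>\<B>. x \<in> V \<and> V \<subseteq> U"
        by metis
    qed
  qed
  moreover have "continuous_map X Y h"
    unfolding Y_def continuous_map_in_subtopology euclidean_product_topology[symmetric]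
      continuous_map_componentwise_UNIV
    using h by auto
  moreover have "continuous_map Y R_omega1 (f \<circ> s)"
    unfolding continuous_map_componentwise
  proof (intro conjI ballI)
    show "(f \<circ> s) ` topspace Y \<subseteq> extensional omega1"
      using fext s(1) by (auto simp: Y_def)
    fix \<alpha> assume \<alpha>: "\<alpha> \<in> omega1"
    have "continuous_on (h ` topspace X) (\<lambda>v. f (s v) \<alpha>)"
      unfolding continuous_on_def
    proof (intro ballI tendstoI)
      fix v and \<epsilon> :: real assume v: "v \<in> h ` topspace X" and \<epsilon>: "\<epsilon> > 0"
      then obtain n \<delta> where \<delta>: "\<delta> > 0"
        "\<forall>y\<in>topspace X. \<bar>h y n - h (s v) n\<bar> < \<delta> \<longrightarrow> \<bar>f y \<alpha> - f (s v) \<alpha>\<bar> < \<epsilon>"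
        using fh[OF \<alpha> s(1)] by blast
      have "continuous_on UNIV (\<lambda>w :: nat \<Rightarrow> real. w n)"
        by (simp add: continuous_on_product_coordinates)
      then have "((\<lambda>w :: nat \<Rightarrow> real. w n) \<longlongrightarrow> v n) (at v within h ` topspace X)"
        using continuous_on_subset[OF _ subset_UNIV, of "\<lambda>w. w n" "h ` topspace X"] v
        unfolding continuous_on_def by blast
      then have "\<forall>\<^sub>F w in at v within h ` topspace X. dist (w n) (v n) < \<delta>"
        using \<delta>(1) by (rule tendstoD)
      moreover have "\<forall>\<^sub>F w in at v within h ` topspace X. w \<in> h ` topspace X"
        by (simp add: eventually_at_filter)
      ultimately show "\<forall>\<^sub>F w in at v within h ` topspace X. dist (f (s w) \<alpha>) (f (s v) \<alpha>) < \<epsilon>"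
        by eventually_elim (use \<delta>(2) s v in \<open>auto simp: dist_real_def\<close>)
    qed
    then show "continuous_map Y euclideanreal (\<lambda>v. (f \<circ> s) v \<alpha>)"
      by (simp add: Y_def)
  qed
  ultimately show ?thesis
    using factor unfolding comp_def by blast
qed

section \<open>Neighbourhoods of the identity in a topological group\<close>

context topological_group
begin

lemma one_in_topspace: "\<one> \<in> topspace T"
  by (simp add: topspace_eq)

lemma eventually_nhdsin_one_iff:
  "eventually (\<lambda>x. x \<in> U) (nhdsin T \<one>) \<longleftrightarrow> (\<exists>V. openin T V \<and> \<one> \<in> V \<and> V \<subseteq> U)"
  unfolding eventually_nhdsin using one_in_topspace by blast

lemma openin_imp_carrier: "openin T V \<Longrightarrow> x \<in> V \<Longrightarrow> x \<in> carrier G"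
  using openin_subset topspace_eq by blast

lemma continuous_map_translation:
  assumes "a \<in> carrier G"
  shows "continuous_map T T (\<lambda>x. a \<otimes> x)"
proof -
  have "continuous_map T (prod_topology T T) (\<lambda>x. (a, x))"
    using assms topspace_eq by (intro continuous_map_pairedI) auto
  from continuous_map_compose[OF this continuous_mult] show ?thesis
    by (simp add: comp_def)
qed

lemma continuous_map_quotient:
  "continuous_map (prod_topology T T) T (\<lambda>(x, y). inv x \<otimes> y)"
proof -
  have "continuous_map (prod_topology T T) (prod_topology T T) (\<lambda>p. (inv (fst p), snd p))"
    by (intro continuous_map_pairedI continuous_map_snd)
       (use continuous_map_compose[OF continuous_map_fst continuous_inv] in \<open>simp add: comp_def\<close>)
  from continuous_map_compose[OF this continuous_mult] show ?thesis
    by (simp add: comp_def case_prod_unfold)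
qed

text \<open>Joint continuity at \<open>(\<one>, \<one>)\<close>, stated for an arbitrary operation so that it serves both for
  products, \<open>V V \<subseteq> U\<close>, and for quotients, \<open>V\<^sup>-\<^sup>1 V \<subseteq> U\<close>.\<close>

lemma nbhd_of_one_binary:
  assumes p: "continuous_map (prod_topology T T) T (\<lambda>(x, y). p x y)" and "p \<one> \<one> = \<one>"
    and U: "openin T U" "\<one> \<in> U"
  obtains V where "openin T V" "\<one> \<in> V" "\<And>x y. x \<in> V \<Longrightarrow> y \<in> V \<Longrightarrow> p x y \<in> U"
proof -
  have "openin (prod_topology T T) {z \<in> topspace (prod_topology T T). (\<lambda>(x, y). p x y) z \<in> U}"
    using p U(1) by (rule openin_continuous_map_preimage)
  then obtain A B where "openin T A" "openin T B" "\<one> \<in> A" "\<one> \<in> B"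
    "A \<times> B \<subseteq> {z \<in> topspace (prod_topology T T). (\<lambda>(x, y). p x y) z \<in> U}"
    unfolding openin_prod_topology_alt using assms one_in_topspace by force
  then show ?thesis
    by (intro that[of "A \<inter> B"]) auto
qed

lemmas nbhd_of_one_mult = nbhd_of_one_binary[OF continuous_mult, simplified]
lemmas nbhd_of_one_quotient = nbhd_of_one_binary[OF continuous_map_quotient, simplified]

lemma nbhd_of_one_symmetric:
  assumes "openin T U" "\<one> \<in> U"
  obtains V where "openin T V" "\<one> \<in> V" "V \<subseteq> U" "\<And>x. x \<in> V \<Longrightarrow> inv x \<in> V"
proof -
  have "openin T {x \<in> topspace T. inv x \<in> U}"
    using continuous_inv assms(1) by (rule openin_continuous_map_preimage)
  then have "openin T (U \<inter> {x \<in> topspace T. inv x \<in> U})"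
    using assms(1) by blast
  then show ?thesis
    using assms one_in_topspace topspace_eq openin_imp_carrier[OF assms(1)]
    by (intro that[of "U \<inter> {x \<in> topspace T. inv x \<in> U}"]) auto
qed

lemma nbhd_of_one_bump:
  assumes "openin T U" "\<one> \<in> U"
  obtains \<phi> where "continuous_map T euclideanreal \<phi>" "\<phi> \<one> = 0"
    "\<And>x. x \<in> carrier G \<Longrightarrow> x \<notin> U \<Longrightarrow> \<phi> x = 1"
proof -
  have "closedin T (topspace T - U)" "\<one> \<in> topspace T - (topspace T - U)"
    using assms one_in_topspace by auto
  then obtain \<phi> :: "'a \<Rightarrow> real" where "continuous_map T (top_of_set {0..1}) \<phi>" "\<phi> \<one> = 0"
    "\<phi> ` (topspace T - U) \<subseteq> {1}"
    using Tychonoff unfolding Tychonoff_space_def completely_regular_space_def by meson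
  then show ?thesis
    using that[of \<phi>] continuous_map_into_fulltopology unfolding topspace_eq by blast
qed

lemma cancel_inv:
  assumes "x \<in> carrier G" "y \<in> carrier G"
  shows "x \<otimes> (inv x \<otimes> y) = y"
  using assms by (simp add: m_assoc[symmetric])

lemma inv_quotient:
  assumes "x \<in> carrier G" "y \<in> carrier G"
  shows "inv (inv x \<otimes> y) = inv y \<otimes> x"
  using assms by (simp add: inv_mult_group)

text \<open>The quotient of two points does not change when both are translated on the left: if \<open>x\<close> and \<open>y\<close> lie in one translate \<open>a U\<close>,
  then \<open>inv x \<otimes> y\<close> lies in \<open>U\<^sup>-\<^sup>1 U\<close>.\<close>

lemma quotient_quotient:
  assumes "a \<in> carrier G" "x \<in> carrier G" "y \<in> carrier G"
  shows "inv (inv a \<otimes> x) \<otimes> (inv a \<otimes> y) = inv x \<otimes> y"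
  using assms by (simp add: inv_mult_group m_assoc cancel_inv)

text \<open>Inverting a cover by right translates \<open>U a\<close> gives a cover by left translates of \<open>U\<^sup>-\<^sup>1\<close>, so
  narrowness may be stated with left translates; \<open>inv a \<otimes> x \<in> U\<close> says \<open>x \<in> a U\<close>. This fits the left
  quotients \<open>inv x \<otimes> y\<close> that measure closeness below.\<close>

lemma omega_narrow_iff:
  "omega_narrow G T \<longleftrightarrow> (\<forall>U. openin T U \<and> \<one> \<in> U \<longrightarrow>
     (\<exists>A. countable A \<and> A \<subseteq> carrier G \<and> (\<forall>x\<in>carrier G. \<exists>a\<in>A. inv a \<otimes> x \<in> U)))"
  (is "_ \<longleftrightarrow> ?R")
proof
  assume narrow: "omega_narrow G T"
  show ?R
  proof (intro allI impI, elim conjE)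
    fix U assume "openin T U" "\<one> \<in> U"
    then obtain V where V: "openin T V" "\<one> \<in> V" "V \<subseteq> U" "\<And>x. x \<in> V \<Longrightarrow> inv x \<in> V"
      by (metis nbhd_of_one_symmetric)
    then obtain A where A: "countable A" "A \<subseteq> carrier G" "V <#> A = carrier G"
      using narrow openin_subset[of T V] topspace_eq eventually_nhdsin_one_iff
      unfolding omega_narrow_def by (metis subset_refl)
    have "\<exists>a \<in> m_inv G ` A. inv a \<otimes> x \<in> U" if x: "x \<in> carrier G" for x
    proof -
      have "inv x \<in> V <#> A"
        using A(3) x by simp
      then obtain v a where va: "v \<in> V" "a \<in> A" "inv x = v \<otimes> a"
        unfolding set_mult_def by blast
      then have c: "v \<in> carrier G" "a \<in> carrier G"
        using A(2) V(1) openin_imp_carrier by blast+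
      have "x = inv a \<otimes> inv v"
        using va(3) c x by (metis inv_inv inv_mult_group)
      then have "inv (inv a) \<otimes> x = inv v"
        using c by (simp add: m_assoc[symmetric])
      moreover have "inv v \<in> U"
        using V(3,4) va(1) by blast
      ultimately show ?thesis
        using va(2) by (intro bexI[of _ "inv a"]) simp_all
    qed
    moreover have "countable (m_inv G ` A)" "m_inv G ` A \<subseteq> carrier G"
      using A by auto
    ultimately show "\<exists>A. countable A \<and> A \<subseteq> carrier G \<and> (\<forall>x\<in>carrier G. \<exists>a\<in>A. inv a \<otimes> x \<in> U)"
      by blast
  qed
next
  assume R: ?R
  show "omega_narrow G T"
    unfolding omega_narrow_def eventually_nhdsin_one_iff
  proof (intro allI impI, elim conjE exE)
    fix U V assume UV: "U \<subseteq> carrier G" "openin T V" "\<one> \<in> V" "V \<subseteq> U"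
    then obtain W where W: "openin T W" "\<one> \<in> W" "W \<subseteq> V" "\<And>x. x \<in> W \<Longrightarrow> inv x \<in> W"
      by (metis nbhd_of_one_symmetric)
    then obtain A where A: "countable A" "A \<subseteq> carrier G" "\<And>x. x\<in>carrier G \<Longrightarrow> \<exists>a\<in>A. inv a \<otimes> x \<in> W"
      using R by metis
    have "x \<in> U <#> m_inv G ` A" if x: "x \<in> carrier G" for x
    proof -
      obtain a where a: "a \<in> A" "inv a \<otimes> inv x \<in> W"
        using A(3)[of "inv x"] x by auto
      then have "inv (inv a \<otimes> inv x) \<in> U" "a \<in> carrier G"
        using W UV A(2) by blast+
      moreover from this have "x = inv (inv a \<otimes> inv x) \<otimes> inv a"
        using x by (simp add: inv_mult_group m_assoc)
      ultimately show ?thesis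
        using a(1) unfolding set_mult_def by blast
    qed
    moreover have "U <#> m_inv G ` A \<subseteq> carrier G"
      using UV(1) A(2) by (intro set_mult_closed) auto
    moreover have "countable (m_inv G ` A)" "m_inv G ` A \<subseteq> carrier G"
      using A by auto
    ultimately show "\<exists>A. countable A \<and> A \<subseteq> carrier G \<and> U <#> A = carrier G"
      by blast
  qed
qed

lemma omega_narrow_cover:
  assumes "omega_narrow G T" "openin T U" "\<one> \<in> U"
  obtains A where "countable A" "A \<subseteq> carrier G" "\<And>x. x \<in> carrier G \<Longrightarrow> \<exists>a\<in>A. inv a \<otimes> x \<in> U"
proof -
  have "\<exists>A. countable A \<and> A \<subseteq> carrier G \<and> (\<forall>x\<in>carrier G. \<exists>a\<in>A. inv a \<otimes> x \<in> U)"
    using assms by (simp add: omega_narrow_iff)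
  then show ?thesis
    using that by (elim exE conjE) simp
qed

section \<open>Factorizable groups\<close>

text \<open>Functions \<open>\<phi> \<alpha>\<close> with \<open>\<phi> \<alpha> \<one> = 0\<close> and \<open>\<phi> \<alpha> = 1\<close> off \<open>S \<alpha>\<close> descend along one map \<open>h\<close> to a
  second-countable \<open>Y\<close>. In \<open>Y\<close> each set where the descended function is below \<open>1\<close> contains a member
  of a countable base at \<open>h \<one>\<close>; the preimage of that member lies in \<open>S \<alpha>\<close>.\<close>

lemma factorizable_imp_omega1_fine:
  assumes "R_omega1_factorizable T"
  shows "omega1_fine G T"
  unfolding omega1_fine_def A_filter_def
proof (intro allI impI)
  fix S :: "nat set \<Rightarrow> 'a set"
  assume "\<forall>\<alpha>\<in>omega1. eventually (\<lambda>x. x \<in> S \<alpha>) (nhdsin T \<one>)"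
  then have S: "\<exists>V. openin T V \<and> \<one> \<in> V \<and> V \<subseteq> S \<alpha>" if "\<alpha> \<in> omega1" for \<alpha>
    using that by (simp add: eventually_nhdsin_one_iff)
  have "\<exists>\<phi>. continuous_map T euclideanreal \<phi> \<and> \<phi> \<one> = 0 \<and> (\<forall>x\<in>carrier G - S \<alpha>. \<phi> x = 1)"
    if "\<alpha> \<in> omega1" for \<alpha>
  proof -
    obtain V where V: "openin T V" "\<one> \<in> V" "V \<subseteq> S \<alpha>"
      using S[OF \<open>\<alpha> \<in> omega1\<close>] by blast
    obtain \<phi> where "continuous_map T euclideanreal \<phi>" "\<phi> \<one> = 0"
      "\<And>x. x \<in> carrier G \<Longrightarrow> x \<notin> V \<Longrightarrow> \<phi> x = 1"
      using nbhd_of_one_bump[OF V(1,2)] by metis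
    then show ?thesis
      using V(3) by (intro exI[of _ \<phi>]) auto
  qed
  then obtain \<phi> :: "nat set \<Rightarrow> 'a \<Rightarrow> real"
    where \<phi>: "\<And>\<alpha>. \<alpha> \<in> omega1 \<Longrightarrow> continuous_map T euclideanreal (\<phi> \<alpha>)"
      "\<And>\<alpha>. \<alpha> \<in> omega1 \<Longrightarrow> \<phi> \<alpha> \<one> = 0"
      "\<And>\<alpha> x. \<alpha> \<in> omega1 \<Longrightarrow> x \<in> carrier G - S \<alpha> \<Longrightarrow> \<phi> \<alpha> x = 1"
    by metis
  obtain Y :: "nat set topology" and h g where Y: "second_countable Y"
    and h: "continuous_map T Y h" and g: "\<And>\<alpha>. \<alpha> \<in> omega1 \<Longrightarrow> continuous_map Y euclideanreal (g \<alpha>)"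
    and gh: "\<And>\<alpha> x. \<alpha> \<in> omega1 \<Longrightarrow> x \<in> topspace T \<Longrightarrow> g \<alpha> (h x) = \<phi> \<alpha> x"
    using R_omega1_factorizable_imp_family_factors[OF assms, of \<phi>] \<phi>(1) by blast
  have h1: "h \<one> \<in> topspace Y"
    using continuous_map_image_subset_topspace[OF h] one_in_topspace by blast
  obtain \<B> where \<B>: "countable \<B>" "\<B> \<noteq> {}" "\<And>B. B \<in> \<B> \<Longrightarrow> openin Y B \<and> h \<one> \<in> B"
    "\<And>U. openin Y U \<Longrightarrow> h \<one> \<in> U \<Longrightarrow> \<exists>B\<in>\<B>. B \<subseteq> U"
  proof -
    obtain \<B> where \<B>: "countable \<B>" "\<And>B. B \<in> \<B> \<Longrightarrow> openin Y B"
      "\<And>U x. openin Y U \<Longrightarrow> x \<in> U \<Longrightarrow> \<exists>B\<in>\<B>. x \<in> B \<and> B \<subseteq> U"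
      using Y unfolding second_countable_def by metis
    show ?thesis
    proof (rule that[of "{B \<in> \<B>. h \<one> \<in> B}"])
      show "{B \<in> \<B>. h \<one> \<in> B} \<noteq> {}"
        using \<B>(3)[OF openin_topspace h1] by blast
      show "\<exists>B\<in>{B \<in> \<B>. h \<one> \<in> B}. B \<subseteq> U" if "openin Y U" "h \<one> \<in> U" for U
        using \<B>(3)[OF that] by blast
    qed (use \<B>(1,2) in auto)
  qed
  define H where "H n = {x \<in> topspace T. h x \<in> from_nat_into \<B> n}" for n
  have "eventually (\<lambda>x. x \<in> H n) (nhdsin T \<one>)" for n
  proof -
    have "openin Y (from_nat_into \<B> n)" "h \<one> \<in> from_nat_into \<B> n"
      using \<B>(3)[OF from_nat_into[OF \<B>(2)]] by blast+
    then have "openin T (H n)" "\<one> \<in> H n"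
      unfolding H_def using h one_in_topspace openin_continuous_map_preimage by auto
    then show ?thesis
      unfolding eventually_nhdsin_one_iff by blast
  qed
  moreover have "\<exists>n. H n \<subseteq> S \<alpha>" if \<alpha>: "\<alpha> \<in> omega1" for \<alpha>
  proof -
    have "openin Y {y \<in> topspace Y. g \<alpha> y \<in> {..<1}}"
      using g[OF \<alpha>] by (rule openin_continuous_map_preimage) simp
    moreover have "h \<one> \<in> {y \<in> topspace Y. g \<alpha> y \<in> {..<1}}"
      using h1 gh[OF \<alpha> one_in_topspace] \<phi>(2)[OF \<alpha>] by simp
    ultimately obtain B where B: "B \<in> \<B>" "B \<subseteq> {y \<in> topspace Y. g \<alpha> y \<in> {..<1}}"
      using \<B>(4) by blast
    then obtain n where "from_nat_into \<B> n = B"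
      using from_nat_into_surj[OF \<B>(1) B(1)] by blast
    have "x \<in> S \<alpha>" if "x \<in> H n" for x
    proof (rule ccontr)
      assume "x \<notin> S \<alpha>"
      have x: "x \<in> topspace T" "h x \<in> B"
        using that \<open>from_nat_into \<B> n = B\<close> by (simp_all add: H_def)
      then have "g \<alpha> (h x) < 1"
        using B(2) by blast
      moreover have "\<phi> \<alpha> x = 1"
        using \<phi>(3)[OF \<alpha>] x(1) \<open>x \<notin> S \<alpha>\<close> topspace_eq by simp
      ultimately show False
        using gh[OF \<alpha> x(1)] by simp
    qed
    then show ?thesis
      by blast
  qed
  ultimately show "\<exists>H :: nat \<Rightarrow> 'a set. (\<forall>n. eventually (\<lambda>x. x \<in> H n) (nhdsin T \<one>)) \<and>
      (\<forall>\<alpha>\<in>omega1. \<exists>n. H n \<subseteq> S \<alpha>)"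
    by blast
qed

text \<open>A maximal set \<open>D\<close> of points with \<open>inv x \<otimes> y \<notin> V\<close> for distinct \<open>x\<close>, \<open>y\<close> has translates covering \<open>G\<close>.
  If it were uncountable, \<open>\<omega>\<^sub>1\<close> of its points would carry functions \<open>\<psi> \<alpha>\<close>, each equal to \<open>0\<close> at its own
  point and to \<open>1\<close> at all the others; factoring them separates \<open>\<omega>\<^sub>1\<close> points of a second-countable
  space.\<close>

lemma factorizable_imp_omega_narrow:
  assumes "R_omega1_factorizable T"
  shows "omega_narrow G T"
  unfolding omega_narrow_iff
proof (intro allI impI, elim conjE)
  fix U assume "openin T U" "\<one> \<in> U"
  then obtain V where V: "openin T V" "\<one> \<in> V" "V \<subseteq> U" "\<And>x. x \<in> V \<Longrightarrow> inv x \<in> V"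
    by (metis nbhd_of_one_symmetric)
  define R where "R x y \<longleftrightarrow> x \<in> carrier G \<and> y \<in> carrier G \<and> inv x \<otimes> y \<in> V" for x y
  have "R y x" if "R x y" for x y
    using that V(4)[of "inv x \<otimes> y"] by (simp add: R_def inv_quotient)
  then obtain D where D: "D \<subseteq> carrier G" "\<And>x y. x \<in> D \<Longrightarrow> y \<in> D \<Longrightarrow> x \<noteq> y \<Longrightarrow> \<not> R x y"
    "\<And>x. x \<in> carrier G - D \<Longrightarrow> \<exists>d\<in>D. R d x"
    using maximal_unrelated_subset[of R "carrier G"] by metis
  have "countable D"
  proof (rule ccontr)
    assume "uncountable D"
    then obtain e where e: "inj_on e omega1" "e ` omega1 \<subseteq> D"
      by (rule uncountable_inj_omega1)
    have eG: "e \<alpha> \<in> carrier G" if "\<alpha> \<in> omega1" for \<alpha>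
      using e(2) D(1) that by blast
    obtain \<phi> where \<phi>: "continuous_map T euclideanreal \<phi>" "\<phi> \<one> = 0"
      "\<And>x. x \<in> carrier G \<Longrightarrow> x \<notin> V \<Longrightarrow> \<phi> x = 1"
      using nbhd_of_one_bump[OF V(1,2)] by metis
    define \<psi> where "\<psi> \<alpha> x = \<phi> (inv (e \<alpha>) \<otimes> x)" for \<alpha> x
    have "continuous_map T euclideanreal (\<psi> \<alpha>)" if "\<alpha> \<in> omega1" for \<alpha>
      using continuous_map_compose[OF continuous_map_translation \<phi>(1), of "inv (e \<alpha>)"] eG[OF that]
      by (simp add: \<psi>_def[abs_def] comp_def)
    then obtain Y :: "nat set topology" and h g where Y: "second_countable Y"
      and h: "continuous_map T Y h" and g: "\<And>\<alpha>. \<alpha> \<in> omega1 \<Longrightarrow> continuous_map Y euclideanreal (g \<alpha>)"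
      and gh: "\<And>\<alpha> x. \<alpha> \<in> omega1 \<Longrightarrow> x \<in> topspace T \<Longrightarrow> g \<alpha> (h x) = \<psi> \<alpha> x"
      using R_omega1_factorizable_imp_family_factors[OF assms, of \<psi>] by blast
    have geq: "g \<alpha> (h (e \<beta>)) = \<psi> \<alpha> (e \<beta>)" if "\<alpha> \<in> omega1" "\<beta> \<in> omega1" for \<alpha> \<beta>
      using gh eG that topspace_eq by simp
    have "countable omega1"
    proof (rule second_countable_imp_countable_separated_family[OF Y])
      fix \<alpha> assume \<alpha>: "\<alpha> \<in> omega1"
      show "openin Y {y \<in> topspace Y. g \<alpha> y \<in> {..<1}}"
        using g[OF \<alpha>] by (rule openin_continuous_map_preimage) simp
      have "h (e \<alpha>) \<in> topspace Y"
        using continuous_map_image_subset_topspace[OF h] eG[OF \<alpha>] topspace_eq by blast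
      then show "h (e \<alpha>) \<in> {y \<in> topspace Y. g \<alpha> y \<in> {..<1}}"
        using geq[OF \<alpha> \<alpha>] eG[OF \<alpha>] \<phi>(2) by (simp add: \<psi>_def)
    next
      fix \<alpha> \<beta> assume \<alpha>\<beta>: "\<alpha> \<in> omega1" "\<beta> \<in> omega1"
        and less: "h (e \<beta>) \<in> {y \<in> topspace Y. g \<alpha> y \<in> {..<1}}"
      then have "inv (e \<alpha>) \<otimes> e \<beta> \<in> V"
        using geq[OF \<alpha>\<beta>] \<phi>(3)[of "inv (e \<alpha>) \<otimes> e \<beta>"] eG by (auto simp: \<psi>_def)
      then have "e \<alpha> = e \<beta>"
        using D(2)[of "e \<alpha>" "e \<beta>"] e(2) \<alpha>\<beta> eG unfolding R_def by blast
      then show "\<alpha> = \<beta>"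
        using e(1) \<alpha>\<beta> by (meson inj_onD)
    qed
    then show False
      using uncountable_omega1 by simp
  qed
  moreover have "\<exists>d\<in>D. inv d \<otimes> x \<in> U" if x: "x \<in> carrier G" for x
  proof (cases "x \<in> D")
    case True
    then show ?thesis
      using V(2,3) x by (metis l_inv subsetD)
  qed (use D(3) V(3) x in \<open>auto simp: R_def\<close>)
  ultimately show "\<exists>A. countable A \<and> A \<subseteq> carrier G \<and> (\<forall>x\<in>carrier G. \<exists>a\<in>A. inv a \<otimes> x \<in> U)"
    using D(1) by blast
qed

section \<open>Narrow and fine groups\<close>

text \<open>Call \<open>x\<close> and \<open>y\<close> close if their quotient lies in both \<open>V x\<close> and \<open>V y\<close>, and let \<open>D\<close> be a maximal set of
  pairwise far points. Maximality gives the cover. Suppose \<open>D\<close> is uncountable. By fineness, a single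
  neighbourhood \<open>H n\<close> of the identity lies in \<open>V x\<close> for uncountably many \<open>x \<in> D\<close>, and by narrowness two
  of these \<open>x\<close> share a translate \<open>a U\<close> with \<open>U\<^sup>-\<^sup>1 U \<subseteq> H n\<close>. Their quotient lies in \<open>H n\<close>, hence in both
  assigned neighbourhoods: they are close. Applied to neighbourhoods \<open>V x\<close> for which \<open>x (V x)\<close> refines a
  given open cover, the lemma shows that \<open>G\<close> is a Lindelof space.\<close>

lemma nbhd_assignment_countable_cover:
  assumes narrow: "omega_narrow G T" and fine: "omega1_fine G T"
    and V: "\<And>x. x \<in> carrier G \<Longrightarrow> openin T (V x) \<and> \<one> \<in> V x"
  obtains D where "countable D" "D \<subseteq> carrier G"
    "\<And>x. x \<in> carrier G \<Longrightarrow> \<exists>d\<in>D. inv d \<otimes> x \<in> V d"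
proof -
  \<comment> \<open>Asking for both quotients makes \<open>R\<close> symmetric although the sets \<open>V x\<close> need not be.\<close>
  define R where "R x y \<longleftrightarrow> inv x \<otimes> y \<in> V x \<inter> V y \<and> inv y \<otimes> x \<in> V x \<inter> V y" for x y
  have "\<And>x y. R x y \<Longrightarrow> R y x"
    unfolding R_def by blast
  then obtain D where D: "D \<subseteq> carrier G" "\<And>x y. x \<in> D \<Longrightarrow> y \<in> D \<Longrightarrow> x \<noteq> y \<Longrightarrow> \<not> R x y"
    "\<And>x. x \<in> carrier G - D \<Longrightarrow> \<exists>d\<in>D. R d x"
    using maximal_unrelated_subset[of R "carrier G"] by metis
  have "countable D"
  proof (rule ccontr)
    assume "uncountable D"
    then obtain e where e: "inj_on e omega1" "e ` omega1 \<subseteq> D"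
      by (rule uncountable_inj_omega1)
    have eG: "e \<alpha> \<in> carrier G" if "\<alpha> \<in> omega1" for \<alpha>
      using e(2) D(1) that by blast
    have "\<forall>\<alpha>\<in>omega1. eventually (\<lambda>x. x \<in> V (e \<alpha>)) (nhdsin T \<one>)"
      unfolding eventually_nhdsin_one_iff using V eG by blast
    then obtain H where H: "\<And>n::nat. eventually (\<lambda>x. x \<in> H n) (nhdsin T \<one>)"
      "\<And>\<alpha>. \<alpha> \<in> omega1 \<Longrightarrow> \<exists>n. H n \<subseteq> V (e \<alpha>)"
      using fine[unfolded omega1_fine_def A_filter_def, rule_format, of "\<lambda>\<alpha>. V (e \<alpha>)"] by metis
    have "omega1 \<subseteq> (\<Union>n. {\<alpha> \<in> omega1. H n \<subseteq> V (e \<alpha>)})"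
      using H(2) by blast
    then have "uncountable (\<Union>n. {\<alpha> \<in> omega1. H n \<subseteq> V (e \<alpha>)})"
      using uncountable_omega1 countable_subset by blast
    then have "\<exists>n. uncountable {\<alpha> \<in> omega1. H n \<subseteq> V (e \<alpha>)}"
      by auto
    then obtain n where n: "uncountable {\<alpha> \<in> omega1. H n \<subseteq> V (e \<alpha>)}" (is "uncountable ?I") ..
    obtain W where W: "openin T W" "\<one> \<in> W" "W \<subseteq> H n"
      using H(1) unfolding eventually_nhdsin_one_iff by blast
    obtain U where U: "openin T U" "\<one> \<in> U" "\<And>x y. x \<in> U \<Longrightarrow> y \<in> U \<Longrightarrow> inv x \<otimes> y \<in> W"
      using nbhd_of_one_quotient[OF W(1,2)] by metis
    obtain A where A: "countable A" "A \<subseteq> carrier G" "\<And>x. x \<in> carrier G \<Longrightarrow> \<exists>a\<in>A. inv a \<otimes> x \<in> U"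
      using omega_narrow_cover[OF narrow U(1,2)] by metis
    have "?I \<subseteq> (\<Union>a\<in>A. {\<alpha> \<in> ?I. inv a \<otimes> e \<alpha> \<in> U})"
      using A(3) eG by blast
    then have "uncountable (\<Union>a\<in>A. {\<alpha> \<in> ?I. inv a \<otimes> e \<alpha> \<in> U})"
      using n countable_subset by blast
    then obtain a where a: "a \<in> A" "uncountable {\<alpha> \<in> ?I. inv a \<otimes> e \<alpha> \<in> U}" (is "uncountable ?J")
      using countable_UN[OF A(1), of "\<lambda>a. {\<alpha> \<in> ?I. inv a \<otimes> e \<alpha> \<in> U}"] by blast
    then have "infinite ?J"
      using countable_finite by blast
    then obtain \<alpha> \<beta> where \<alpha>\<beta>: "\<alpha> \<in> ?J" "\<beta> \<in> ?J" "\<alpha> \<noteq> \<beta>"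
      by (metis (no_types, lifting) finite.simps infinite_imp_nonempty insertI1 is_singletonI' is_singleton_def
          ex_in_conv)
    have ac: "a \<in> carrier G"
      using a(1) A(2) by blast
    have "inv (e \<alpha>) \<otimes> e \<beta> \<in> W" "inv (e \<beta>) \<otimes> e \<alpha> \<in> W"
      using U(3)[of "inv a \<otimes> e \<alpha>" "inv a \<otimes> e \<beta>"] U(3)[of "inv a \<otimes> e \<beta>" "inv a \<otimes> e \<alpha>"]
        \<alpha>\<beta> eG by (auto simp: quotient_quotient ac)
    then have "R (e \<alpha>) (e \<beta>)"
      using \<alpha>\<beta> W(3) unfolding R_def by blast
    moreover have "e \<alpha> \<noteq> e \<beta>"
      using e(1) \<alpha>\<beta> by (metis (no_types, lifting) inj_onD mem_Collect_eq)
    ultimately show False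
      using D(2) e(2) \<alpha>\<beta> by blast
  qed
  moreover have "\<exists>d\<in>D. inv d \<otimes> x \<in> V d" if x: "x \<in> carrier G" for x
  proof (cases "x \<in> D")
    case True
    then show ?thesis
      using V x by (metis l_inv)
  qed (use D(3) x in \<open>auto simp: R_def\<close>)
  ultimately show ?thesis
    using that D(1) by blast
qed

text \<open>Countably many neighbourhoods of the identity witness \<open>\<epsilon>\<close>-continuity at all points. Choose \<open>W d\<close>
  such that \<open>f\<close> varies by less than \<open>\<epsilon>/2\<close> from \<open>f d\<close> on \<open>d (W d) (W d)\<close>; countably many sets \<open>d (W d)\<close>
  cover \<open>G\<close>, and for \<open>x \<in> d (W d)\<close> the neighbourhood \<open>x (W d)\<close> stays inside \<open>d (W d) (W d)\<close>.\<close>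

lemma omega_uniformly_continuous:
  assumes narrow: "omega_narrow G T" and fine: "omega1_fine G T"
    and f: "continuous_map T euclideanreal f" and \<epsilon>: "\<epsilon> > 0"
  obtains V :: "nat \<Rightarrow> 'a set" where "\<And>n. openin T (V n) \<and> \<one> \<in> V n"
    "\<And>x. x \<in> carrier G \<Longrightarrow>
       \<exists>n. \<forall>y\<in>carrier G. inv x \<otimes> y \<in> V n \<longrightarrow> \<bar>f y - f x\<bar> < \<epsilon>"
proof -
  have "\<exists>W. openin T W \<and> \<one> \<in> W \<and> (\<forall>u\<in>W. \<forall>w\<in>W. \<bar>f (x \<otimes> (u \<otimes> w)) - f x\<bar> < \<epsilon> / 2)"
    if x: "x \<in> carrier G" for x
  proof -
    have "continuous_map T euclideanreal (\<lambda>y. f (x \<otimes> y))"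
      using continuous_map_compose[OF continuous_map_translation[OF x] f] by (simp add: comp_def)
    moreover define B where "B = {y \<in> topspace T. f (x \<otimes> y) \<in> ball (f x) (\<epsilon> / 2)}"
    ultimately have B: "openin T B"
      using openin_continuous_map_preimage[of T euclideanreal _ "ball (f x) (\<epsilon> / 2)"] by simp
    have "\<one> \<in> B"
      using x \<epsilon> one_in_topspace by (simp add: B_def)
    then obtain W where W: "openin T W" "\<one> \<in> W" "\<And>u w. u \<in> W \<Longrightarrow> w \<in> W \<Longrightarrow> u \<otimes> w \<in> B"
      using nbhd_of_one_mult[OF B] by metis
    show ?thesis
      using W by (intro exI[of _ W]) (auto simp: B_def dist_real_def abs_minus_commute)
  qed
  then obtain W where W: "\<And>x. x \<in> carrier G \<Longrightarrow> openin T (W x) \<and> \<one> \<in> W x"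
    "\<And>x u w. x \<in> carrier G \<Longrightarrow> u \<in> W x \<Longrightarrow> w \<in> W x \<Longrightarrow> \<bar>f (x \<otimes> (u \<otimes> w)) - f x\<bar> < \<epsilon> / 2"
    by metis
  obtain D where D: "countable D" "D \<subseteq> carrier G"
    "\<And>x. x \<in> carrier G \<Longrightarrow> \<exists>d\<in>D. inv d \<otimes> x \<in> W d"
    using nbhd_assignment_countable_cover[OF narrow fine, of W] W(1) by metis
  have "D \<noteq> {}"
    using D(3)[OF one_closed] by blast
  show ?thesis
  proof (rule that[of "\<lambda>n. W (from_nat_into D n)"])
    show "openin T (W (from_nat_into D n)) \<and> \<one> \<in> W (from_nat_into D n)" for n
      using W(1) D(2) from_nat_into[OF \<open>D \<noteq> {}\<close>] by blast
    fix x assume x: "x \<in> carrier G"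
    then obtain d where d: "d \<in> D" "inv d \<otimes> x \<in> W d"
      using D(3) by blast
    then have dG: "d \<in> carrier G"
      using D(2) by blast
    obtain n where n: "from_nat_into D n = d"
      using from_nat_into_surj[OF D(1) d(1)] by blast
    have "\<bar>f y - f x\<bar> < \<epsilon>" if y: "y \<in> carrier G" "inv x \<otimes> y \<in> W d" for y
    proof -
      have eq: "d \<otimes> ((inv d \<otimes> x) \<otimes> (inv x \<otimes> y)) = y" "d \<otimes> ((inv d \<otimes> x) \<otimes> \<one>) = x"
        using x y(1) dG by (simp_all add: m_assoc cancel_inv)
      have "\<one> \<in> W d"
        using W(1)[OF dG] by (rule conjunct2)
      then have "\<bar>f y - f d\<bar> < \<epsilon> / 2" "\<bar>f x - f d\<bar> < \<epsilon> / 2"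
        using W(2)[OF dG d(2) y(2), unfolded eq(1)] W(2)[OF dG d(2), of \<one>, unfolded eq(2)]
        by simp_all
      then show ?thesis
        by linarith
    qed
    then show "\<exists>n. \<forall>y\<in>carrier G. inv x \<otimes> y \<in> W (from_nat_into D n) \<longrightarrow> \<bar>f y - f x\<bar> < \<epsilon>"
      using n by blast
  qed
qed

text \<open>The neighbourhoods obtained for the separate functions are indexed by \<open>\<omega>\<^sub>1 \<times> \<nat> \<times> \<nat>\<close>. Fineness is
  applied for each fixed pair of naturals, which avoids an enumeration of this product by \<open>\<omega>\<^sub>1\<close>.\<close>

lemma nbhd_sequence_for_family:
  assumes narrow: "omega_narrow G T" and fine: "omega1_fine G T"
    and f: "\<And>\<alpha>. \<alpha> \<in> omega1 \<Longrightarrow> continuous_map T euclideanreal (\<lambda>x. f x \<alpha>)"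
  obtains H :: "nat \<Rightarrow> 'a set" where "\<And>n. openin T (H n) \<and> \<one> \<in> H n"
    "\<And>\<alpha> x \<epsilon>. \<alpha> \<in> omega1 \<Longrightarrow> x \<in> carrier G \<Longrightarrow> \<epsilon> > 0 \<Longrightarrow>
       \<exists>n. \<forall>y\<in>carrier G. inv x \<otimes> y \<in> H n \<longrightarrow> \<bar>f y \<alpha> - f x \<alpha>\<bar> < \<epsilon>"
proof -
  have "\<exists>V :: nat \<Rightarrow> 'a set. (\<forall>n. openin T (V n) \<and> \<one> \<in> V n) \<and> (\<forall>x\<in>carrier G.
       \<exists>n. \<forall>y\<in>carrier G. inv x \<otimes> y \<in> V n \<longrightarrow> \<bar>f y \<alpha> - f x \<alpha>\<bar> < 1 / Suc k)"
    if "\<alpha> \<in> omega1" for \<alpha> and k :: nat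
    by (rule omega_uniformly_continuous[OF narrow fine f[OF that], of "1 / Suc k"]) (simp, blast)
  then obtain V :: "nat set \<Rightarrow> nat \<Rightarrow> nat \<Rightarrow> 'a set"
    where V: "\<And>\<alpha> k n. \<alpha> \<in> omega1 \<Longrightarrow> openin T (V \<alpha> k n) \<and> \<one> \<in> V \<alpha> k n"
      "\<And>\<alpha> k x. \<alpha> \<in> omega1 \<Longrightarrow> x \<in> carrier G \<Longrightarrow>
         \<exists>n. \<forall>y\<in>carrier G. inv x \<otimes> y \<in> V \<alpha> k n \<longrightarrow> \<bar>f y \<alpha> - f x \<alpha>\<bar> < 1 / Suc k"
    by metis
  have "\<exists>H :: nat \<Rightarrow> 'a set. (\<forall>m. openin T (H m) \<and> \<one> \<in> H m) \<and> (\<forall>\<alpha>\<in>omega1. \<exists>m. H m \<subseteq> V \<alpha> k n)"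
    for k n
  proof -
    have "\<forall>\<alpha>\<in>omega1. eventually (\<lambda>x. x \<in> V \<alpha> k n) (nhdsin T \<one>)"
      unfolding eventually_nhdsin_one_iff using V(1) by blast
    then obtain H where H: "\<And>m::nat. eventually (\<lambda>x. x \<in> H m) (nhdsin T \<one>)"
      "\<And>\<alpha>. \<alpha> \<in> omega1 \<Longrightarrow> \<exists>m. H m \<subseteq> V \<alpha> k n"
      using fine[unfolded omega1_fine_def A_filter_def, rule_format, of "\<lambda>\<alpha>. V \<alpha> k n"] by metis
    obtain K where "\<And>m. openin T (K m) \<and> \<one> \<in> K m \<and> K m \<subseteq> H m"
      using H(1) unfolding eventually_nhdsin_one_iff by metis
    then show ?thesis
      using H(2) by (meson subset_trans)
  qed
  then obtain H where H: "\<And>k n m :: nat. openin T (H k n m) \<and> \<one> \<in> H k n m"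
    "\<And>k n \<alpha>. \<alpha> \<in> omega1 \<Longrightarrow> \<exists>m. H k n m \<subseteq> V \<alpha> k n"
    by metis
  define K where "K i = (case from_nat i of (k, n, m) \<Rightarrow> H k n m)" for i
  have K: "K (to_nat (k, n, m)) = H k n m" for k n m
    by (simp add: K_def)
  show ?thesis
  proof (rule that[of K])
    show "openin T (K i) \<and> \<one> \<in> K i" for i
      unfolding K_def using H(1) by (simp split: prod.split)
    fix \<alpha> x and \<epsilon> :: real assume \<alpha>: "\<alpha> \<in> omega1" and x: "x \<in> carrier G" and "\<epsilon> > 0"
    then obtain k where k: "1 / Suc k < \<epsilon>"
      using nat_approx_posE by blast
    obtain n where n: "\<forall>y\<in>carrier G. inv x \<otimes> y \<in> V \<alpha> k n \<longrightarrow> \<bar>f y \<alpha> - f x \<alpha>\<bar> < 1 / Suc k"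
      using V(2)[OF \<alpha> x] by blast
    obtain m where "H k n m \<subseteq> V \<alpha> k n"
      using H(2)[OF \<alpha>] by blast
    then have "\<forall>y\<in>carrier G. inv x \<otimes> y \<in> K (to_nat (k, n, m)) \<longrightarrow> \<bar>f y \<alpha> - f x \<alpha>\<bar> < \<epsilon>"
      using n k unfolding K by (meson less_trans subsetD)
    then show "\<exists>i. \<forall>y\<in>carrier G. inv x \<otimes> y \<in> K i \<longrightarrow> \<bar>f y \<alpha> - f x \<alpha>\<bar> < \<epsilon>" ..
  qed
qed

text \<open>Take a bump \<open>\<phi>\<close> that is \<open>0\<close> at the identity and \<open>1\<close> off \<open>U\<close>, where \<open>U\<^sup>-\<^sup>1 U \<subseteq> H\<close>, and translate it to
  countably many points \<open>a\<close> such that the sets \<open>a {\<phi> < 1/2}\<close> cover \<open>G\<close>. If \<open>x\<close> lies in the set of \<open>a\<close> and the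
  translated bump changes by less than \<open>1/2\<close> from \<open>x\<close> to \<open>y\<close>, its value at \<open>y\<close> is below \<open>1\<close>; so
  \<open>x\<close> and \<open>y\<close> both lie in \<open>a U\<close>.\<close>

lemma translates_detect_nbhd:
  assumes narrow: "omega_narrow G T" and H: "openin T H" "\<one> \<in> H"
  obtains h :: "nat \<Rightarrow> 'a \<Rightarrow> real" where "\<And>n. continuous_map T euclideanreal (h n)"
    "\<And>x. x \<in> carrier G \<Longrightarrow>
       \<exists>n. \<forall>y\<in>carrier G. \<bar>h n y - h n x\<bar> < 1/2 \<longrightarrow> inv x \<otimes> y \<in> H"
proof -
  obtain U where U: "openin T U" "\<one> \<in> U" "\<And>x y. x \<in> U \<Longrightarrow> y \<in> U \<Longrightarrow> inv x \<otimes> y \<in> H"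
    using nbhd_of_one_quotient[OF H] by metis
  obtain \<phi> where \<phi>: "continuous_map T euclideanreal \<phi>" "\<phi> \<one> = 0"
    "\<And>x. x \<in> carrier G \<Longrightarrow> x \<notin> U \<Longrightarrow> \<phi> x = 1"
    using nbhd_of_one_bump[OF U(1,2)] by metis
  have "openin T {x \<in> topspace T. \<phi> x \<in> {..<1/2}}" (is "openin T ?U'")
    using \<phi>(1) by (rule openin_continuous_map_preimage) simp
  moreover have "\<one> \<in> ?U'"
    using \<phi>(2) one_in_topspace by simp
  ultimately obtain A where A: "countable A" "A \<subseteq> carrier G"
    "\<And>x. x \<in> carrier G \<Longrightarrow> \<exists>a\<in>A. inv a \<otimes> x \<in> ?U'"
    by (rule omega_narrow_cover[OF narrow]) metis
  have "A \<noteq> {}"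
    using A(3)[OF one_closed] by blast
  define h where "h n x = \<phi> (inv (from_nat_into A n) \<otimes> x)" for n x
  show ?thesis
  proof (rule that[of h])
    have "from_nat_into A n \<in> carrier G" for n
      using A(2) from_nat_into[OF \<open>A \<noteq> {}\<close>] by blast
    then show "continuous_map T euclideanreal (h n)" for n
      using continuous_map_compose[OF continuous_map_translation \<phi>(1), of "inv (from_nat_into A n)"]
      by (simp add: h_def[abs_def] comp_def)
    fix x assume x: "x \<in> carrier G"
    then obtain a where a: "a \<in> A" "inv a \<otimes> x \<in> ?U'"
      using A(3) by blast
    then have aG: "a \<in> carrier G"
      using A(2) by blast
    obtain n where n: "from_nat_into A n = a"
      using from_nat_into_surj[OF A(1) a(1)] by blast
    have "inv x \<otimes> y \<in> H" if y: "y \<in> carrier G" "\<bar>h n y - h n x\<bar> < 1/2" for y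
    proof -
      have "\<phi> (inv a \<otimes> x) < 1" "\<phi> (inv a \<otimes> y) < 1"
        using a(2) y(2) unfolding h_def n mem_Collect_eq lessThan_iff by linarith+
      then have "inv a \<otimes> x \<in> U" "inv a \<otimes> y \<in> U"
        using \<phi>(3)[of "inv a \<otimes> x"] \<phi>(3)[of "inv a \<otimes> y"] x y(1) aG by auto
      then show ?thesis
        using U(3) quotient_quotient[OF aG x y(1)] by metis
    qed
    then show "\<exists>n. \<forall>y\<in>carrier G. \<bar>h n y - h n x\<bar> < 1/2 \<longrightarrow> inv x \<otimes> y \<in> H"
      by blast
  qed
qed

lemma omega_narrow_omega1_fine_imp_factorizable:
  assumes narrow: "omega_narrow G T" and fine: "omega1_fine G T"
  shows "R_omega1_factorizable T"
proof (rule R_omega1_factorizableI)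
  fix f assume f: "continuous_map T R_omega1 f"
  then have "continuous_map T euclideanreal (\<lambda>x. f x \<alpha>)" if "\<alpha> \<in> omega1" for \<alpha>
    using that by (simp add: continuous_map_componentwise)
  then obtain H :: "nat \<Rightarrow> 'a set" where H: "\<And>m. openin T (H m) \<and> \<one> \<in> H m"
    "\<And>\<alpha> x \<epsilon>. \<alpha> \<in> omega1 \<Longrightarrow> x \<in> carrier G \<Longrightarrow> \<epsilon> > 0 \<Longrightarrow>
       \<exists>m. \<forall>y\<in>carrier G. inv x \<otimes> y \<in> H m \<longrightarrow> \<bar>f y \<alpha> - f x \<alpha>\<bar> < \<epsilon>"
    using nbhd_sequence_for_family[OF narrow fine, of f] by blast
  have "\<exists>h :: nat \<Rightarrow> 'a \<Rightarrow> real. (\<forall>n. continuous_map T euclideanreal (h n)) \<and> (\<forall>x\<in>carrier G.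
      \<exists>n. \<forall>y\<in>carrier G. \<bar>h n y - h n x\<bar> < 1/2 \<longrightarrow> inv x \<otimes> y \<in> H m)" for m
    using translates_detect_nbhd[OF narrow, of "H m"] H(1) by metis
  then have "\<exists>h :: nat \<Rightarrow> nat \<Rightarrow> 'a \<Rightarrow> real. \<forall>m. (\<forall>n. continuous_map T euclideanreal (h m n)) \<and>
      (\<forall>x\<in>carrier G. \<exists>n. \<forall>y\<in>carrier G. \<bar>h m n y - h m n x\<bar> < 1/2 \<longrightarrow> inv x \<otimes> y \<in> H m)"
    by (intro choice allI)
  then obtain h :: "nat \<Rightarrow> nat \<Rightarrow> 'a \<Rightarrow> real"
    where "\<forall>m. (\<forall>n. continuous_map T euclideanreal (h m n)) \<and>
      (\<forall>x\<in>carrier G. \<exists>n. \<forall>y\<in>carrier G. \<bar>h m n y - h m n x\<bar> < 1/2 \<longrightarrow> inv x \<otimes> y \<in> H m)"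
    by (elim exE)
  then have h: "\<And>m n. continuous_map T euclideanreal (h m n)"
    "\<And>m x. x \<in> carrier G \<Longrightarrow>
       \<exists>n. \<forall>y\<in>carrier G. \<bar>h m n y - h m n x\<bar> < 1/2 \<longrightarrow> inv x \<otimes> y \<in> H m"
    by simp_all
  define k where "k x i = h (fst (prod_decode i)) (snd (prod_decode i)) x" for x i
  show "\<exists>(Y :: (nat \<Rightarrow> real) topology) h g. Tychonoff_space Y \<and> second_countable Y \<and>
      continuous_map T Y h \<and> continuous_map Y R_omega1 g \<and> (\<forall>x\<in>topspace T. f x = g (h x))"
  proof (rule factorization_through_real_sequence[OF f])
    show "continuous_map T euclideanreal (\<lambda>x. k x i)" for i
      unfolding k_def by (rule h(1))
    fix \<alpha> x and \<epsilon> :: real assume "\<alpha> \<in> omega1" "x \<in> topspace T" "\<epsilon> > 0"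
    then obtain m where m: "\<forall>y\<in>carrier G. inv x \<otimes> y \<in> H m \<longrightarrow> \<bar>f y \<alpha> - f x \<alpha>\<bar> < \<epsilon>"
      and x: "x \<in> carrier G"
      using H(2) topspace_eq by metis
    obtain n where n: "\<forall>y\<in>carrier G. \<bar>h m n y - h m n x\<bar> < 1/2 \<longrightarrow> inv x \<otimes> y \<in> H m"
      using h(2)[OF x] by blast
    show "\<exists>i. \<exists>\<delta>>0. \<forall>y\<in>topspace T. \<bar>k y i - k x i\<bar> < \<delta> \<longrightarrow> \<bar>f y \<alpha> - f x \<alpha>\<bar> < \<epsilon>"
      by (intro exI[of _ "prod_encode (m, n)"] exI[of _ "1/2"])
         (use m n in \<open>auto simp: k_def topspace_eq\<close>)
  qed
qed

end

theorem theorem5p3: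
  fixes G :: "('a, 'b) monoid_scheme" and T :: "'a topology"
  assumes "topological_group G T"
  shows "R_omega1_factorizable T \<longleftrightarrow> omega_narrow G T \<and> omega1_fine G T"
  using topological_group.factorizable_imp_omega_narrow[OF assms]
    topological_group.factorizable_imp_omega1_fine[OF assms]
    topological_group.omega_narrow_omega1_fine_imp_factorizable[OF assms]
  by blast

end
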